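(* Let $X,Y$ be smooth vector fields on the Grassmannian $G_q$. Then, for any $\beta\in G_q$, the Levi-Civita connection of $G_q$ satisfies $$\left(\nabla^{G_q}_XY\right)_\beta=[\![\Omega'(\beta),\beta]\!],\qquad\text{where}\qquad\Omega'(\beta)=\left.\frac{d}{dt}\right|_{t=0}[\![Y(\Gamma(t)),\Gamma(t)]\!],$$ and $\Gamma$ is the geodesic in $G_q$ through $\beta$ in the direction $X(\beta)$.
   Context: $[\![A,B]\!]=AB-BA$ for $n\times n$ real matrices. For $1\le q\le n$, $G_q=\{P\in\mathbb{R}^{n\times n}:P^2=P,\ P^T=P,\ \mathrm{rank}(P)=q\}$ is the Grassmannian realized as orthogonal projectors, a submanifold of the space $\mathrm{Sym}_n$ of symmetric matrices. $SO(n)$ acts transitively on $G_q$ by $Q\cdot P=QPQ^T$. $SO(n)$ carries the bi-invariant metric $g^O_Q(Q\Omega,Q\widetilde\Omega)=\frac12\mathrm{tr}(\Omega^T\widetilde\Omega)$, $\Omega,\widetilde\Omega\in\mathfrak{so}(n)$. $G_q$ carries the metric for which the diffeomorphism from the quotient of $SO(n)$ by the isotropy group of $P_0=\mathrm{Diag}[I_q,0_{n-q}]$ (with the quotient metric of $g^O$) onto $G_q$ induced by $Q\mapsto QP_0Q^T$ is an isometry. Values of vector fields on $G_q$ are regarded as symmetric matrices. *)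

theory Defs
  imports "HOL-Analysis.Analysis"
begin

section \<open>Smooth maps\<close>

text \<open>Only meaningful for open \<open>S\<close>.\<close>

primrec Ck_on :: "nat \<Rightarrow> 'a::real_normed_vector set \<Rightarrow> ('a \<Rightarrow> 'b::real_normed_vector) \<Rightarrow> bool" where
  "Ck_on 0 S f \<longleftrightarrow> continuous_on S f"
| "Ck_on (Suc k) S f \<longleftrightarrow>
     (\<forall>x\<in>S. f differentiable (at x)) \<and> (\<forall>v. Ck_on k S (\<lambda>x. frechet_derivative f (at x) v))"

definition smooth_on :: "'a::real_normed_vector set \<Rightarrow> ('a \<Rightarrow> 'b::real_normed_vector) \<Rightarrow> bool" where
  "smooth_on S f \<longleftrightarrow> (\<forall>k. Ck_on k S f)"


section \<open>Calculus on a submanifold of a Euclidean space\<close>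

text \<open>
  Throughout, \<open>M\<close> is the underlying set of an embedded submanifold of a Euclidean space, and tensor
  fields and functions on \<open>M\<close> are represented by total functions of which only the values on \<open>M\<close>
  matter.
\<close>

definition smooth_map :: "'a::euclidean_space set \<Rightarrow> ('a \<Rightarrow> 'b::real_normed_vector) \<Rightarrow> bool" where
  "smooth_map M f \<longleftrightarrow>
     (\<forall>x\<in>M. \<exists>U F. open U \<and> x \<in> U \<and> smooth_on U F \<and> (\<forall>y\<in>U \<inter> M. F y = f y))"

definition curve_through :: "'a::euclidean_space set \<Rightarrow> 'a \<Rightarrow> 'a \<Rightarrow> (real \<Rightarrow> 'a) \<Rightarrow> bool" where
  "curve_through M x v c \<longleftrightarrow>
     (\<exists>e>0. smooth_on {-e<..<e} c \<and> c ` {-e<..<e} \<subseteq> M) \<and>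
     c 0 = x \<and> (c has_vector_derivative v) (at 0)"

definition tangent_space :: "'a::euclidean_space set \<Rightarrow> 'a \<Rightarrow> 'a set" where
  "tangent_space M x = {v. \<exists>c. curve_through M x v c}"

text \<open>
  The derivative \<open>v f\<close> of a map \<open>f\<close> smooth on \<open>M\<close> along a tangent vector \<open>v\<close> at \<open>x\<close>; it does not
  depend on the curve representing \<open>v\<close>.
\<close>

definition tangent_deriv ::
  "'a::euclidean_space set \<Rightarrow> ('a \<Rightarrow> 'b::real_normed_vector) \<Rightarrow> 'a \<Rightarrow> 'a \<Rightarrow> 'b" where
  "tangent_deriv M f x v =
     (THE d. \<exists>c. curve_through M x v c \<and> ((\<lambda>t. f (c t)) has_vector_derivative d) (at 0))"

definition smooth_vector_field :: "'a::euclidean_space set \<Rightarrow> ('a \<Rightarrow> 'a) \<Rightarrow> bool" where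
  "smooth_vector_field M X \<longleftrightarrow> smooth_map M X \<and> (\<forall>x\<in>M. X x \<in> tangent_space M x)"

text \<open>\<open>Z\<close> is the Lie bracket of \<open>X\<close> and \<open>Y\<close>, i.e. \<open>Z f = X (Y f) - Y (X f)\<close>.\<close>

definition is_lie_bracket ::
  "'a::euclidean_space set \<Rightarrow> ('a \<Rightarrow> 'a) \<Rightarrow> ('a \<Rightarrow> 'a) \<Rightarrow> ('a \<Rightarrow> 'a) \<Rightarrow> bool" where
  "is_lie_bracket M X Y Z \<longleftrightarrow>
     smooth_vector_field M Z \<and>
     (\<forall>f :: 'a \<Rightarrow> real. smooth_map M f \<longrightarrow>
        (\<forall>x\<in>M. tangent_deriv M f x (Z x) =
           tangent_deriv M (\<lambda>y. tangent_deriv M f y (Y y)) x (X x) -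
           tangent_deriv M (\<lambda>y. tangent_deriv M f y (X y)) x (Y x)))"


section \<open>Connections and geodesics\<close>

text \<open>
  Linearity over smooth functions and the Leibniz rule, applied to functions \<open>f\<close> vanishing on \<open>M\<close>
  but arbitrary off \<open>M\<close>, make the values of \<open>nabla X Y\<close> on \<open>M\<close> independent of the values of \<open>X\<close>
  and \<open>Y\<close> off \<open>M\<close>.
\<close>

definition affine_connection ::
  "'a::euclidean_space set \<Rightarrow> (('a \<Rightarrow> 'a) \<Rightarrow> ('a \<Rightarrow> 'a) \<Rightarrow> ('a \<Rightarrow> 'a)) \<Rightarrow> bool" where
  "affine_connection M nabla \<longleftrightarrow>
     (\<forall>X Y. smooth_vector_field M X \<and> smooth_vector_field M Y \<longrightarrow>
        smooth_vector_field M (nabla X Y)) \<and>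
     (\<forall>X X' Y (f :: 'a \<Rightarrow> real) (h :: 'a \<Rightarrow> real).
        smooth_vector_field M X \<and> smooth_vector_field M X' \<and> smooth_vector_field M Y \<and>
        smooth_map M f \<and> smooth_map M h \<longrightarrow>
        (\<forall>x\<in>M. nabla (\<lambda>y. f y *\<^sub>R X y + h y *\<^sub>R X' y) Y x =
           f x *\<^sub>R nabla X Y x + h x *\<^sub>R nabla X' Y x)) \<and>
     (\<forall>X Y Y' (a :: real) (b :: real).
        smooth_vector_field M X \<and> smooth_vector_field M Y \<and> smooth_vector_field M Y' \<longrightarrow>
        (\<forall>x\<in>M. nabla X (\<lambda>y. a *\<^sub>R Y y + b *\<^sub>R Y' y) x =
           a *\<^sub>R nabla X Y x + b *\<^sub>R nabla X Y' x)) \<and>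
     (\<forall>X Y (f :: 'a \<Rightarrow> real).
        smooth_vector_field M X \<and> smooth_vector_field M Y \<and> smooth_map M f \<longrightarrow>
        (\<forall>x\<in>M. nabla X (\<lambda>y. f y *\<^sub>R Y y) x =
           f x *\<^sub>R nabla X Y x + tangent_deriv M f x (X x) *\<^sub>R Y x))"

definition levi_civita ::
  "'a::euclidean_space set \<Rightarrow> ('a \<Rightarrow> 'a \<Rightarrow> 'a \<Rightarrow> real) \<Rightarrow>
   (('a \<Rightarrow> 'a) \<Rightarrow> ('a \<Rightarrow> 'a) \<Rightarrow> ('a \<Rightarrow> 'a)) \<Rightarrow> bool" where
  "levi_civita M g nabla \<longleftrightarrow>
     affine_connection M nabla \<and>
     (\<forall>X Y. smooth_vector_field M X \<and> smooth_vector_field M Y \<longrightarrow>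
        is_lie_bracket M X Y (\<lambda>x. nabla X Y x - nabla Y X x)) \<and>
     (\<forall>X Y Z. smooth_vector_field M X \<and> smooth_vector_field M Y \<and> smooth_vector_field M Z \<longrightarrow>
        (\<forall>x\<in>M. tangent_deriv M (\<lambda>y. g y (Y y) (Z y)) x (X x) =
           g x (nabla X Y x) (Z x) + g x (Y x) (nabla X Z x)))"

definition smooth_field_along ::
  "'a::euclidean_space set \<Rightarrow> real set \<Rightarrow> (real \<Rightarrow> 'a) \<Rightarrow> (real \<Rightarrow> 'a) \<Rightarrow> bool" where
  "smooth_field_along M I c V \<longleftrightarrow> smooth_on I V \<and> (\<forall>t\<in>I. V t \<in> tangent_space M (c t))"

text \<open>\<open>D\<close> is the covariant derivative along \<open>c\<close> induced by \<open>nabla\<close>, by its defining properties.\<close>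

definition covariant_derivative_along ::
  "'a::euclidean_space set \<Rightarrow> (('a \<Rightarrow> 'a) \<Rightarrow> ('a \<Rightarrow> 'a) \<Rightarrow> ('a \<Rightarrow> 'a)) \<Rightarrow>
   real set \<Rightarrow> (real \<Rightarrow> 'a) \<Rightarrow> ((real \<Rightarrow> 'a) \<Rightarrow> (real \<Rightarrow> 'a)) \<Rightarrow> bool" where
  "covariant_derivative_along M nabla I c D \<longleftrightarrow>
     (\<forall>V. smooth_field_along M I c V \<longrightarrow> smooth_field_along M I c (D V)) \<and>
     (\<forall>V W (a :: real) (b :: real).
        smooth_field_along M I c V \<and> smooth_field_along M I c W \<longrightarrow>
        (\<forall>t\<in>I. D (\<lambda>s. a *\<^sub>R V s + b *\<^sub>R W s) t = a *\<^sub>R D V t + b *\<^sub>R D W t)) \<and>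
     (\<forall>V (f :: real \<Rightarrow> real).
        smooth_field_along M I c V \<and> smooth_on I f \<longrightarrow>
        (\<forall>t\<in>I. D (\<lambda>s. f s *\<^sub>R V s) t = deriv f t *\<^sub>R V t + f t *\<^sub>R D V t)) \<and>
     (\<forall>X Y t. smooth_vector_field M X \<and> smooth_vector_field M Y \<and> t \<in> I \<and>
        X (c t) = vector_derivative c (at t) \<longrightarrow>
        D (\<lambda>s. Y (c s)) t = nabla X Y (c t))"

definition geodesic_on ::
  "'a::euclidean_space set \<Rightarrow> (('a \<Rightarrow> 'a) \<Rightarrow> ('a \<Rightarrow> 'a) \<Rightarrow> ('a \<Rightarrow> 'a)) \<Rightarrow>
   real set \<Rightarrow> (real \<Rightarrow> 'a) \<Rightarrow> bool" where
  "geodesic_on M nabla I c \<longleftrightarrow>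
     open I \<and> is_interval I \<and> smooth_on I c \<and> c ` I \<subseteq> M \<and>
     (\<exists>D. covariant_derivative_along M nabla I c D \<and>
        (\<forall>t\<in>I. D (\<lambda>s. vector_derivative c (at s)) t = 0))"


section \<open>The Grassmannian as a quotient of the special orthogonal group\<close>

type_synonym 'n sq_matrix = "((real, 'n) vec, 'n) vec"

definition commutator :: "'n::finite sq_matrix \<Rightarrow> 'n sq_matrix \<Rightarrow> 'n sq_matrix" where
  "commutator A B = A ** B - B ** A"

definition grassmannian :: "nat \<Rightarrow> 'n::finite sq_matrix set" where
  "grassmannian q = {P. P ** P = P \<and> transpose P = P \<and> rank P = q}"

definition special_orthogonal :: "'n::finite sq_matrix set" where
  "special_orthogonal = {Q. orthogonal_matrix Q \<and> det Q = 1}"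

definition so_algebra :: "'n::finite sq_matrix set" where
  "so_algebra = {W. transpose W = - W}"

text \<open>
  \<open>Diag [I_q, 0]\<close>. The order on the index type plays the role of the order on \<open>{1..n}\<close>, so that the
  condition below says that \<open>i\<close> is one of the first \<open>q\<close> indices.
\<close>

definition P0 :: "nat \<Rightarrow> 'n::{finite,linorder} sq_matrix" where
  "P0 q = (\<chi> i j. if i = j \<and> card {k. k < i} < q then 1 else 0)"

definition orbit_map :: "nat \<Rightarrow> 'n::{finite,linorder} sq_matrix \<Rightarrow> 'n sq_matrix" where
  "orbit_map q Q = Q ** P0 q ** transpose Q"

abbreviation orbit_map_deriv ::
  "nat \<Rightarrow> 'n::{finite,linorder} sq_matrix \<Rightarrow> 'n sq_matrix \<Rightarrow> 'n sq_matrix" where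
  "orbit_map_deriv q Q \<equiv> frechet_derivative (orbit_map q) (at Q)"

text \<open>For \<open>Q\<close> orthogonal, \<open>U = Q ** W\<close> is the same as \<open>W = transpose Q ** U\<close>.\<close>

definition tangent_SO :: "'n::finite sq_matrix \<Rightarrow> 'n sq_matrix set" where
  "tangent_SO Q = {Q ** W | W. W \<in> so_algebra}"

definition metric_SO :: "'n::finite sq_matrix \<Rightarrow> 'n sq_matrix \<Rightarrow> 'n sq_matrix \<Rightarrow> real" where
  "metric_SO Q U V = trace (transpose (transpose Q ** U) ** (transpose Q ** V)) / 2"

definition vertical_space :: "nat \<Rightarrow> 'n::{finite,linorder} sq_matrix \<Rightarrow> 'n sq_matrix set" where
  "vertical_space q Q = {U \<in> tangent_SO Q. orbit_map_deriv q Q U = 0}"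

definition horizontal_space :: "nat \<Rightarrow> 'n::{finite,linorder} sq_matrix \<Rightarrow> 'n sq_matrix set" where
  "horizontal_space q Q = {U \<in> tangent_SO Q. \<forall>V\<in>vertical_space q Q. metric_SO Q U V = 0}"

text \<open>
  The fibres of \<open>orbit_map q\<close> on \<open>special_orthogonal\<close> are the cosets of the isotropy group of
  \<open>P0 q\<close>. The quotient metric, transported to the Grassmannian, is therefore the metric that makes
  \<open>orbit_map q\<close> a Riemannian submersion: the inner product of \<open>u\<close> and \<open>v\<close> is that of their
  horizontal lifts at any point \<open>Q\<close> of the fibre over \<open>P\<close>.
\<close>

definition grassmann_metric ::
  "nat \<Rightarrow> 'n::{finite,linorder} sq_matrix \<Rightarrow> 'n sq_matrix \<Rightarrow> 'n sq_matrix \<Rightarrow> real" where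
  "grassmann_metric q P u v =
     (THE r. \<exists>Q U V. Q \<in> special_orthogonal \<and> orbit_map q Q = P \<and>
        U \<in> horizontal_space q Q \<and> V \<in> horizontal_space q Q \<and>
        orbit_map_deriv q Q U = u \<and> orbit_map_deriv q Q V = v \<and> r = metric_SO Q U V)"

end

theory Submission
  imports Defs
begin

text \<open>
  The quotient metric on the Grassmannian is half the Frobenius inner product: horizontal lifts of a
  tangent vector \<open>u\<close> at \<open>P\<close> are the left translates of \<open>[u, P]\<close>, and bracketing with \<open>P\<close> is an
  isometry of the tangent space onto its image. The Koszul argument then identifies the Levi-Civita
  connection with the orthogonal projection of the ambient derivative, and the projection of a
  symmetric matrix \<open>Z\<close> onto the tangent space at \<open>P\<close> is \<open>[[Z, P], P]\<close>. Since \<open>[Y, X]\<close> commutes with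
  \<open>\<beta>\<close> for tangent vectors \<open>X\<close>, \<open>Y\<close> at \<open>\<beta>\<close>, only the term \<open>[Y', \<beta>]\<close> of \<open>\<Omega>'\<close> contributes to
  \<open>[\<Omega>', \<beta>]\<close>.
\<close>

section \<open>Closure properties of smooth maps\<close>

lemma Ck_on_Suc_deriv:
  assumes "Ck_on (Suc k) S f" and "x \<in> S"
  shows "(f has_derivative frechet_derivative f (at x)) (at x)"
  using assms by (simp add: frechet_derivative_works[symmetric])

text \<open>On an open set, functions that agree have the same Frechet derivative at each point, so
  all iterated derivatives agree as well.\<close>

lemma Ck_on_cong:
  assumes "open S" and "Ck_on k S f" and "\<And>x. x \<in> S \<Longrightarrow> f x = g x"
  shows "Ck_on k S g"
  using assms(2,3)
proof (induction k arbitrary: f g)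
  case 0
  then show ?case by (auto cong: continuous_on_cong)
next
  case (Suc k)
  have deriv: "(g has_derivative frechet_derivative f (at x)) (at x)" if "x \<in> S" for x
    using Suc.prems(2) that
    by (intro has_derivative_transform_within_open[OF Ck_on_Suc_deriv[OF Suc.prems(1) that] \<open>open S\<close>]) auto
  then have "frechet_derivative f (at x) = frechet_derivative g (at x)" if "x \<in> S" for x
    using frechet_derivative_at that by blast
  then have "Ck_on k S (\<lambda>x. frechet_derivative g (at x) v)" for v
    using Suc.prems(1) by (auto intro: Suc.IH[of "\<lambda>x. frechet_derivative f (at x) v"])
  with deriv show ?case by (auto simp: differentiable_def)
qed

text \<open>Replaces the abstract \<open>frechet_derivative\<close> in the recursion by an explicit
  formula \<open>f'\<close>, which is what the inductions below work with.\<close>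

lemma Ck_on_SucI:
  assumes "open S" and "\<And>x. x \<in> S \<Longrightarrow> (f has_derivative f' x) (at x)"
    and "\<And>v. Ck_on k S (\<lambda>x. f' x v)"
  shows "Ck_on (Suc k) S f"
proof -
  have "f' x = frechet_derivative f (at x)" if "x \<in> S" for x
    using assms(2)[OF that] by (rule frechet_derivative_at)
  then show ?thesis
    using assms(2) by (auto simp: differentiable_def intro: Ck_on_cong[OF assms(1) assms(3)])
qed

lemma Ck_on_SucD: "Ck_on (Suc k) S f \<Longrightarrow> Ck_on k S f"
proof (induction k arbitrary: f)
  case 0
  then show ?case
    by (auto intro: differentiable_imp_continuous_on differentiable_at_imp_differentiable_on)
next
  case (Suc k)
  then show ?case by (metis Ck_on.simps(2))
qed

lemma Ck_on_const: "open S \<Longrightarrow> Ck_on k S (\<lambda>x. c)"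
proof (induction k arbitrary: c)
  case (Suc k)
  then show ?case by (intro Ck_on_SucI[where f' = "\<lambda>x v. 0"]) auto
qed simp

lemma Ck_on_bounded_linear:
  assumes "open S" and "bounded_linear L" and "Ck_on k S f"
  shows "Ck_on k S (\<lambda>x. L (f x))"
  using assms(3)
proof (induction k arbitrary: f)
  case 0
  then show ?case using bounded_linear.continuous_on[OF assms(2)] by simp
next
  case (Suc k)
  have "((\<lambda>x. L (f x)) has_derivative (\<lambda>v. L (frechet_derivative f (at x) v))) (at x)" if "x \<in> S" for x
    using Ck_on_Suc_deriv[OF Suc.prems that] by (rule bounded_linear.has_derivative[OF assms(2)])
  then show ?case
    using Suc by (intro Ck_on_SucI[OF assms(1)]) auto
qed

lemma Ck_on_add:
  assumes "open S" and "Ck_on k S f" and "Ck_on k S g"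
  shows "Ck_on k S (\<lambda>x. f x + g x)"
  using assms(2,3)
proof (induction k arbitrary: f g)
  case 0
  then show ?case by (auto intro: continuous_on_add)
next
  case (Suc k)
  have "Ck_on k S (\<lambda>x. frechet_derivative f (at x) v + frechet_derivative g (at x) v)" for v
    using Suc.prems by (intro Suc.IH) auto
  then show ?case
    using has_derivative_add[OF Ck_on_Suc_deriv[OF Suc.prems(1)] Ck_on_Suc_deriv[OF Suc.prems(2)]]
    by (intro Ck_on_SucI[OF assms(1)])
qed

text \<open>The product rule writes the derivative as two terms of the same bilinear shape, with
  factors \<open>f\<close>, \<open>g'\<close> and \<open>f'\<close>, \<open>g\<close>. The induction
  hypothesis covers both once the undifferentiated factors are lowered by one order with
  \<open>Ck_on_SucD\<close>.\<close>

lemma Ck_on_bounded_bilinear: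
  assumes "open S" and "bounded_bilinear h" and "Ck_on k S f" and "Ck_on k S g"
  shows "Ck_on k S (\<lambda>x. h (f x) (g x))"
  using assms(3,4)
proof (induction k arbitrary: f g)
  case 0
  then show ?case using bounded_bilinear.continuous_on[OF assms(2)] by simp
next
  case (Suc k)
  have "Ck_on k S (\<lambda>x. h (f x) (frechet_derivative g (at x) v) + h (frechet_derivative f (at x) v) (g x))" for v
    using Suc.prems Ck_on_SucD[OF Suc.prems(1)] Ck_on_SucD[OF Suc.prems(2)]
    by (intro Ck_on_add[OF assms(1)] Suc.IH) auto
  then show ?case
    using bounded_bilinear.FDERIV[OF assms(2) Ck_on_Suc_deriv[OF Suc.prems(1)] Ck_on_Suc_deriv[OF Suc.prems(2)]]
    by (intro Ck_on_SucI[OF assms(1)])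
qed

lemma Ck_on_id:
  assumes "open S"
  shows "Ck_on k S (\<lambda>x. x)"
proof (cases k)
  case 0
  then show ?thesis by (simp add: continuous_on_id)
next
  case (Suc m)
  then show ?thesis
    using assms by (auto simp del: Ck_on.simps(2) intro: Ck_on_SucI[OF _ has_derivative_ident] Ck_on_const)
qed

lemma smooth_on_differentiable:
  assumes "smooth_on S f" and "x \<in> S"
  shows "(f has_derivative frechet_derivative f (at x)) (at x)"
  using assms Ck_on_Suc_deriv unfolding smooth_on_def by blast

lemma smooth_on_subset: "smooth_on S f \<Longrightarrow> T \<subseteq> S \<Longrightarrow> smooth_on T f"
proof -
  have "Ck_on k S f \<Longrightarrow> T \<subseteq> S \<Longrightarrow> Ck_on k T f" for k
    by (induction k arbitrary: f) (auto intro: continuous_on_subset)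
  then show "smooth_on S f \<Longrightarrow> T \<subseteq> S \<Longrightarrow> smooth_on T f"
    by (auto simp: smooth_on_def)
qed

lemma smooth_map_of_smooth_on_UNIV: "smooth_on UNIV f \<Longrightarrow> smooth_map M f"
  by (auto simp: smooth_map_def intro!: exI[of _ UNIV] exI[of _ f])


section \<open>Derivatives along tangent vectors\<close>

lemma smooth_map_extension:
  assumes "smooth_map M f" and "x \<in> M"
  obtains F F' U where "(F has_derivative F') (at x)" and "open U" and "x \<in> U" and "\<forall>y\<in>U \<inter> M. F y = f y"
  using assms unfolding smooth_map_def by (meson smooth_on_differentiable)

lemma curve_throughD:
  assumes "curve_through M x v c"
  shows "c 0 = x" and "(c has_vector_derivative v) (at 0)" and "eventually (\<lambda>t. c t \<in> M) (nhds 0)"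
    and "x \<in> M"
proof -
  from assms obtain e :: real where e: "e > 0" "c ` {-e<..<e} \<subseteq> M"
    by (auto simp: curve_through_def)
  then show "eventually (\<lambda>t. c t \<in> M) (nhds 0)"
    by (auto simp: eventually_nhds intro!: exI[of _ "{-e<..<e}"])
  show "c 0 = x" "(c has_vector_derivative v) (at 0)"
    using assms by (auto simp: curve_through_def)
  then show "x \<in> M" using e by (metis eventually_nhds_x_imp_x \<open>eventually (\<lambda>t. c t \<in> M) (nhds 0)\<close>)
qed

text \<open>The curve stays in \<open>M\<close> and, by continuity, in \<open>U\<close> near 0, so
  there \<open>f\<close> may be replaced by its extension \<open>F\<close> and the chain rule
  applies. The value \<open>F' v\<close> does not depend on the curve, which makes
  \<open>tangent_deriv\<close> well defined.\<close>

lemma curve_through_deriv: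
  assumes c: "curve_through M x v c" and F: "(F has_derivative F') (at x)"
    and "open U" and "x \<in> U" and eq: "\<forall>y\<in>U \<inter> M. F y = f y"
  shows "((\<lambda>t. f (c t)) has_vector_derivative F' v) (at 0)"
proof -
  have c': "(c has_derivative (\<lambda>h. h *\<^sub>R v)) (at 0)"
    using curve_throughD(2)[OF c] by (simp add: has_vector_derivative_def)
  then have "((\<lambda>t. F (c t)) has_derivative (\<lambda>h. F' (h *\<^sub>R v))) (at 0)"
    using has_derivative_compose[OF c'] F curve_throughD(1)[OF c] by simp
  then have deriv: "((\<lambda>t. F (c t)) has_vector_derivative F' v) (at 0)"
    using linear_cmul[OF has_derivative_linear[OF F]] by (simp add: has_vector_derivative_def)
  have "(c \<longlongrightarrow> c 0) (nhds 0)"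
    using has_derivative_continuous[OF c'] by (simp add: continuous_at tendsto_at_iff_tendsto_nhds)
  then have "eventually (\<lambda>t. c t \<in> U) (nhds 0)"
    using assms(3,4) curve_throughD(1)[OF c] by (auto intro: topological_tendstoD)
  with curve_throughD(3)[OF c] have "eventually (\<lambda>t. F (c t) = f (c t)) (nhds 0)"
    by eventually_elim (simp add: eq)
  \<comment> \<open>Transferring the derivative needs agreement on a punctured neighbourhood of 0
    and also at 0 itself.\<close>
  then have ev: "eventually (\<lambda>t. F (c t) = f (c t)) (at 0)" "F (c 0) = f (c 0)"
    by (auto simp: eventually_at_filter eventually_mono dest: eventually_nhds_x_imp_x)
  show ?thesis
    using deriv ev unfolding has_vector_derivative_def
    by (auto elim!: has_derivative_transform_eventually)
qed

lemma tangent_deriv_eq: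
  assumes "v \<in> tangent_space M x" and "(F has_derivative F') (at x)"
    and "open U" and "x \<in> U" and "\<forall>y\<in>U \<inter> M. F y = f y"
  shows "tangent_deriv M f x v = F' v"
proof -
  have *: "((\<lambda>t. f (c t)) has_vector_derivative F' v) (at 0)" if "curve_through M x v c" for c
    using curve_through_deriv[OF that assms(2-5)] .
  with assms(1) show ?thesis
    unfolding tangent_deriv_def tangent_space_def
    by (intro the_equality) (blast, metis vector_derivative_unique_at)
qed

text \<open>The definition speaks of some curve representing \<open>v\<close>; here every such curve
  computes the derivative, so that a geodesic can be used in the main result.\<close>

lemma tangent_deriv_curve:
  assumes "smooth_map M f" and "curve_through M x v c"
  shows "((\<lambda>t. f (c t)) has_vector_derivative tangent_deriv M f x v) (at 0)"
proof -
  obtain F F' U where F: "(F has_derivative F') (at x)" "open U" "x \<in> U" "\<forall>y\<in>U \<inter> M. F y = f y"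
    using smooth_map_extension[OF assms(1) curve_throughD(4)[OF assms(2)]] .
  have "v \<in> tangent_space M x"
    using assms(2) by (auto simp: tangent_space_def)
  from tangent_deriv_eq[OF this F] curve_through_deriv[OF assms(2) F] show ?thesis by simp
qed

text \<open>Agreement is demanded on \<open>M\<close> only: that is all a derivative along curves in
  \<open>M\<close> sees, and tensor fields carry arbitrary values off \<open>M\<close>.\<close>

lemma tangent_deriv_bounded_linear:
  assumes "bounded_linear L" and "smooth_map M f" and "v \<in> tangent_space M x" "x \<in> M"
    and "\<And>y. y \<in> M \<Longrightarrow> g y = L (f y)"
  shows "tangent_deriv M g x v = L (tangent_deriv M f x v)"
proof -
  obtain F F' U where F: "(F has_derivative F') (at x)" "open U" "x \<in> U" "\<forall>y\<in>U \<inter> M. F y = f y"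
    using smooth_map_extension[OF assms(2,4)] .
  have "tangent_deriv M g x v = L (F' v)"
    using F assms(5)
    by (intro tangent_deriv_eq[OF assms(3) bounded_linear.has_derivative[OF assms(1) F(1)] F(2,3)]) auto
  with tangent_deriv_eq[OF assms(3) F] show ?thesis by simp
qed

lemma tangent_deriv_bounded_bilinear:
  assumes "bounded_bilinear h" and "smooth_map M f" and "smooth_map M g"
    and "v \<in> tangent_space M x" and "x \<in> M" and "\<And>y. y \<in> M \<Longrightarrow> k y = h (f y) (g y)"
  shows "tangent_deriv M k x v = h (f x) (tangent_deriv M g x v) + h (tangent_deriv M f x v) (g x)"
proof -
  obtain F F' U where F: "(F has_derivative F') (at x)" "open U" "x \<in> U" "\<forall>y\<in>U \<inter> M. F y = f y"
    using smooth_map_extension[OF assms(2,5)] .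
  obtain G G' V where G: "(G has_derivative G') (at x)" "open V" "x \<in> V" "\<forall>y\<in>V \<inter> M. G y = g y"
    using smooth_map_extension[OF assms(3,5)] .
  have "tangent_deriv M k x v = h (F x) (G' v) + h (F' v) (G x)"
    using F G assms(6)
    by (intro tangent_deriv_eq[OF assms(4) bounded_bilinear.FDERIV[OF assms(1) F(1) G(1)], of "U \<inter> V"]) auto
  with tangent_deriv_eq[OF assms(4) F] tangent_deriv_eq[OF assms(4) G] F G assms(5) show ?thesis by simp
qed


section \<open>Matrices\<close>

lemma bounded_bilinear_matrix_mult:
  "bounded_bilinear ((**) :: real^'n^'m \<Rightarrow> real^'p^'n \<Rightarrow> real^'p^'m)"
  unfolding bilinear_conv_bounded_bilinear[symmetric] bilinear_def
  by (auto intro!: linearI simp: matrix_matrix_mult_def vec_eq_iff sum.distrib sum_distrib_left algebra_simps)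

lemmas matrix_mult_add_left = bounded_bilinear.add_left[OF bounded_bilinear_matrix_mult]
  and matrix_mult_add_right = bounded_bilinear.add_right[OF bounded_bilinear_matrix_mult]
  and matrix_mult_diff_left = bounded_bilinear.diff_left[OF bounded_bilinear_matrix_mult]
  and matrix_mult_diff_right = bounded_bilinear.diff_right[OF bounded_bilinear_matrix_mult]
  and matrix_mult_minus_left = bounded_bilinear.minus_left[OF bounded_bilinear_matrix_mult]
  and matrix_mult_minus_right = bounded_bilinear.minus_right[OF bounded_bilinear_matrix_mult]
  and matrix_mult_scaleR_left = bounded_bilinear.scaleR_left[OF bounded_bilinear_matrix_mult]
  and matrix_mult_scaleR_right = bounded_bilinear.scaleR_right[OF bounded_bilinear_matrix_mult]

lemmas matrix_mult_distribs = matrix_mult_add_left matrix_mult_add_right matrix_mult_diff_left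
  matrix_mult_diff_right matrix_mult_minus_left matrix_mult_minus_right
  matrix_mult_scaleR_left matrix_mult_scaleR_right

lemma bounded_linear_transpose: "bounded_linear (transpose :: real^'n^'m \<Rightarrow> real^'m^'n)"
  by (intro linear_conv_bounded_linear[THEN iffD1] linearI) (auto simp: transpose_def vec_eq_iff)

lemmas transpose_add = linear_add[OF bounded_linear.linear[OF bounded_linear_transpose]]
  and transpose_diff = linear_diff[OF bounded_linear.linear[OF bounded_linear_transpose]]
  and transpose_minus = linear_neg[OF bounded_linear.linear[OF bounded_linear_transpose]]
  and transpose_scaleR = linear_cmul[OF bounded_linear.linear[OF bounded_linear_transpose]]

lemmas transpose_distribs = transpose_add transpose_diff transpose_minus transpose_scaleR matrix_transpose_mul

section \<open>The Frobenius inner product and orthogonal matrices\<close>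

lemma trace_transpose_mult: "trace (transpose A ** B) = A \<bullet> B"
  for A B :: "real^'n^'m"
  unfolding trace_def transpose_def matrix_matrix_mult_def inner_vec_def
  by (simp add: sum.swap[of _ "UNIV :: 'n set"])

lemma inner_matrix_mult_left: "(A ** B) \<bullet> C = B \<bullet> (transpose A ** C)"
  for A :: "real^'n^'m" and B :: "real^'p^'n"
  by (simp add: trace_transpose_mult[symmetric] matrix_transpose_mul matrix_mul_assoc)

lemma inner_matrix_mult_right: "(A ** B) \<bullet> C = A \<bullet> (C ** transpose B)"
  for A :: "real^'n^'m" and B :: "real^'p^'n"
  by (simp add: trace_transpose_mult[symmetric] matrix_transpose_mul)
    (metis matrix_mul_assoc trace_mul_sym)

lemma orthogonal_matrixD:
  assumes "orthogonal_matrix Q"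
  shows "transpose Q ** Q = mat 1" and "Q ** transpose Q = mat 1"
    and "transpose Q ** (Q ** A) = A" and "Q ** (transpose Q ** A) = A"
    and "B ** transpose Q ** Q = B" and "B ** Q ** transpose Q = B"
proof -
  show *: "transpose Q ** Q = mat 1" "Q ** transpose Q = mat 1"
    using assms by (auto simp: orthogonal_matrix_def)
  show "transpose Q ** (Q ** A) = A" "Q ** (transpose Q ** A) = A"
    by (simp_all add: * matrix_mul_assoc)
  show "B ** transpose Q ** Q = B" "B ** Q ** transpose Q = B"
    by (simp_all add: * matrix_mul_assoc[symmetric])
qed

lemma inner_orthogonal_conjugate:
  fixes Q A B :: "real^'n^'n"
  assumes "orthogonal_matrix Q"
  shows "(Q ** A ** transpose Q) \<bullet> (Q ** B ** transpose Q) = A \<bullet> B"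
proof -
  have "(Q ** A ** transpose Q) \<bullet> (Q ** B ** transpose Q) = (Q ** A) \<bullet> (Q ** B)"
    by (subst inner_matrix_mult_right) (simp add: orthogonal_matrixD[OF assms])
  also have "\<dots> = A \<bullet> B"
    by (subst inner_matrix_mult_left) (simp add: orthogonal_matrixD[OF assms])
  finally show ?thesis .
qed

lemma rank_orthogonal_conjugate:
  fixes Q A :: "real^'n^'n"
  assumes "orthogonal_matrix Q"
  shows "rank (Q ** A ** transpose Q) = rank A"
proof (rule antisym)
  show "rank (Q ** A ** transpose Q) \<le> rank A"
    using order_trans[OF rank_mul_le_left rank_mul_le_right] .
  have "A = transpose Q ** (Q ** A ** transpose Q) ** Q"
    by (simp add: matrix_mul_assoc orthogonal_matrixD[OF assms])
  also have "rank \<dots> \<le> rank (Q ** A ** transpose Q)"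
    using order_trans[OF rank_mul_le_left rank_mul_le_right] .
  finally show "rank A \<le> rank (Q ** A ** transpose Q)" .
qed

subsection \<open>The Cayley transform\<close>

text \<open>For skew \<open>A\<close>, the matrix \<open>A ** Z\<close> is orthogonal to
  \<open>Z\<close>, so the square of the right-hand norm is the sum of the squared norms of
  \<open>Z\<close> and \<open>A ** Z\<close>. Taking \<open>Z\<close> to be the inverse of
  \<open>mat 1 - A\<close> bounds that inverse independently of \<open>A\<close>.\<close>

lemma norm_mat1_minus_skew:
  fixes A Z :: "real^'n^'n"
  assumes "transpose A = - A"
  shows "norm Z \<le> norm ((mat 1 - A) ** Z)"
proof -
  have "Z \<bullet> (A ** Z) = 0"
    using inner_matrix_mult_left[of A Z Z] by (simp add: assms matrix_mult_distribs inner_commute)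
  then have "((mat 1 - A) ** Z) \<bullet> ((mat 1 - A) ** Z) = Z \<bullet> Z + (A ** Z) \<bullet> (A ** Z)"
    by (simp add: matrix_mult_distribs inner_diff inner_commute)
  then show ?thesis by (simp add: norm_eq_sqrt_inner)
qed

lemma mat1_minus_skew_inverse:
  fixes A :: "real^'n^'n"
  assumes "transpose A = - A"
  obtains B where "(mat 1 - A) ** B = mat 1" and "B ** (mat 1 - A) = mat 1" and "norm B \<le> norm (mat 1 :: real^'n^'n)"
proof -
  have "x = 0" if "(mat 1 - A) *v x = 0" for x
  proof -
    have Ax: "A *v x = x"
      using that by (simp add: matrix_vector_mult_diff_rdistrib)
    have "x \<bullet> (A *v x) = (transpose A *v x) \<bullet> x"
      by (simp add: dot_lmul_matrix)
    also have "transpose A *v x = - (A *v x)"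
      unfolding assms by (simp add: matrix_vector_mult_def vec_eq_iff sum_negf)
    finally show ?thesis by (simp add: Ax)
  qed
  then obtain B where B: "B ** (mat 1 - A) = mat 1"
    unfolding matrix_left_invertible_ker[symmetric] by (metis matrix_left_invertible_ker)
  then have "(mat 1 - A) ** B = mat 1"
    by (simp add: matrix_left_right_inverse)
  with B norm_mat1_minus_skew[OF assms, of B] that show ?thesis by simp
qed

text \<open>The Cayley transform t -> (1 + tC)(1 - tC)^(-1) of a skew matrix C stays in the
  orthogonal group and is defined for all t. It serves as a rational substitute for the
  exponential.\<close>

lemma orthogonal_curve_with_velocity:
  fixes A :: "real^'n^'n"
  assumes "transpose A = - A"
  obtains Q where "smooth_on UNIV Q" and "\<And>t. orthogonal_matrix (Q t)"
    and "Q 0 = mat 1" and "(Q has_vector_derivative A) (at (0::real))"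
proof -
  \<comment> \<open>The numerator and the inverse each contribute C to the velocity at 0, hence the
    factor 1/2.\<close>
  define C where "C = (1/2) *\<^sub>R A"
  have skew: "transpose (t *\<^sub>R C) = - (t *\<^sub>R C)" for t
    by (simp add: C_def transpose_distribs assms)
  have "\<exists>B. (mat 1 - t *\<^sub>R C) ** B = mat 1 \<and> B ** (mat 1 - t *\<^sub>R C) = mat 1 \<and> norm B \<le> norm (mat 1 :: real^'n^'n)" for t
    using mat1_minus_skew_inverse[OF skew[of t]] by blast
  then obtain B where B: "\<And>t. (mat 1 - t *\<^sub>R C) ** B t = mat 1" "\<And>t. B t ** (mat 1 - t *\<^sub>R C) = mat 1"
    and B_le: "\<And>t. norm (B t) \<le> norm (mat 1 :: real^'n^'n)"
    by metis
  \<comment> \<open>Resolvent identity. With the uniform bound on \<open>B\<close> it gives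
    Lipschitz continuity, and then the derivative of \<open>B\<close>.\<close>
  have diff: "B t - B s = (t - s) *\<^sub>R (B t ** C ** B s)" for t s
  proof -
    have "B t - B s = B t ** ((mat 1 - s *\<^sub>R C) ** B s) - (B t ** (mat 1 - t *\<^sub>R C)) ** B s"
      by (simp only: B) simp
    also have "\<dots> = (t - s) *\<^sub>R (B t ** C ** B s)"
      by (simp add: matrix_mult_distribs matrix_mul_assoc algebra_simps)
    finally show ?thesis .
  qed
  obtain K where K: "\<And>(a :: real^'n^'n) (b :: real^'n^'n). norm (a ** b) \<le> norm a * norm b * K" "K > 0"
    using bounded_bilinear.pos_bounded[OF bounded_bilinear_matrix_mult] by blast
  define L where "L = norm (mat 1 :: real^'n^'n) * norm C * K * norm (mat 1 :: real^'n^'n) * K"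
  have "norm (B t ** C ** B s) \<le> L" for t s
  proof -
    have "norm (B t ** C ** B s) \<le> norm (B t ** C) * norm (B s) * K"
      by (rule K)
    also have "\<dots> \<le> norm (B t) * norm C * K * norm (B s) * K"
      using \<open>K > 0\<close> by (intro mult_right_mono K) auto
    also have "\<dots> \<le> L"
      unfolding L_def using B_le \<open>K > 0\<close> by (intro mult_mono) auto
    finally show ?thesis .
  qed
  then have "norm (B t - B s) \<le> L * norm (t - s)" for t s
    by (simp add: diff mult.commute[of L] mult_left_mono)
  moreover have "0 \<le> L"
    using \<open>K > 0\<close> by (simp add: L_def)
  ultimately have "L-lipschitz_on UNIV B"
    by (intro lipschitz_onI) (auto simp: dist_norm)
  then have cont: "isCont B t" for t
    using lipschitz_on_continuous_on continuous_on_eq_continuous_at open_UNIV by blast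
  \<comment> \<open>By the resolvent identity the difference quotient equals
    \<open>B t ** C ** B s\<close>, and continuity of \<open>B\<close> supplies the limit.\<close>
  have deriv: "(B has_vector_derivative B s ** C ** B s) (at s)" for s
  proof -
    have "((\<lambda>t. B t ** C ** B s - B s ** C ** B s) \<longlongrightarrow> B s ** C ** B s - B s ** C ** B s) (at s)"
      using cont[of s] unfolding isCont_def
      by (intro tendsto_diff bounded_bilinear.tendsto[OF bounded_bilinear_matrix_mult] tendsto_const) auto
    then have "((\<lambda>t. norm (B t ** C ** B s - B s ** C ** B s)) \<longlongrightarrow> 0) (at s)"
      by (simp add: tendsto_norm_zero)
    moreover have "norm (B t ** C ** B s - B s ** C ** B s) = norm (B t - B s - (t - s) *\<^sub>R (B s ** C ** B s)) / norm (t - s)"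
      if "t \<noteq> s" for t
      using that by (simp add: diff scaleR_right_diff_distrib[symmetric])
    ultimately have "((\<lambda>t. norm (B t - B s - (t - s) *\<^sub>R (B s ** C ** B s)) / norm (t - s)) \<longlongrightarrow> 0) (at s)"
      by (auto elim!: Lim_transform_eventually simp: eventually_at_filter)
    then show ?thesis
      by (simp add: has_vector_derivative_def has_derivative_iff_norm bounded_linear_scaleR_left)
  qed
  \<comment> \<open>Bootstrapping: the derivative \<open>B ** C ** B\<close> is a product of maps
    that are already of class k.\<close>
  have B_smooth: "Ck_on k UNIV B" for k
  proof (induction k)
    case 0
    then show ?case using cont by (simp add: continuous_on_eq_continuous_at)
  next
    case (Suc k)
    have "Ck_on k UNIV (\<lambda>t. v *\<^sub>R (B t ** C ** B t))" for v :: real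
      using Suc by (intro Ck_on_bounded_linear[OF _ bounded_linear_scaleR_right]
          Ck_on_bounded_bilinear[OF _ bounded_bilinear_matrix_mult] Ck_on_const) auto
    then show ?case
      using deriv by (intro Ck_on_SucI) (auto simp: has_vector_derivative_def)
  qed
  define Q where "Q t = (mat 1 + t *\<^sub>R C) ** B t" for t
  have "smooth_on UNIV Q"
    unfolding Q_def smooth_on_def
    by (intro allI Ck_on_bounded_bilinear[OF _ bounded_bilinear_matrix_mult] Ck_on_add
        Ck_on_bounded_linear[OF _ bounded_linear_scaleR_left] Ck_on_const Ck_on_id B_smooth) auto
  moreover have "orthogonal_matrix (Q t)" for t
  proof -
    have tB: "transpose (B t) ** (mat 1 + t *\<^sub>R C) = mat 1"
      using arg_cong[OF B(1)[of t], of transpose] by (simp add: transpose_distribs skew[unfolded transpose_scaleR])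
    have "transpose (Q t) ** Q t = transpose (B t) ** ((mat 1 - t *\<^sub>R C) ** (mat 1 + t *\<^sub>R C)) ** B t"
      by (simp add: Q_def transpose_distribs skew[unfolded transpose_scaleR] matrix_mul_assoc)
    \<comment> \<open>Both factors are polynomials in C and commute; after the swap each one meets
      its own inverse.\<close>
    also have "(mat 1 - t *\<^sub>R C) ** (mat 1 + t *\<^sub>R C) = (mat 1 + t *\<^sub>R C) ** (mat 1 - t *\<^sub>R C)"
      by (simp add: matrix_mult_distribs algebra_simps)
    also have "transpose (B t) ** ((mat 1 + t *\<^sub>R C) ** (mat 1 - t *\<^sub>R C)) ** B t =
        (transpose (B t) ** (mat 1 + t *\<^sub>R C)) ** ((mat 1 - t *\<^sub>R C) ** B t)"
      by (simp add: matrix_mul_assoc)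
    finally show ?thesis by (simp add: tB B orthogonal_matrix)
  qed
  moreover have B0: "B 0 = mat 1" using B(1)[of 0] by simp
  then have "Q 0 = mat 1" by (simp add: Q_def)
  moreover have "(Q has_vector_derivative A) (at 0)"
  proof -
    have "((\<lambda>t. mat 1 + t *\<^sub>R C) has_vector_derivative C) (at 0)"
      by (auto intro!: derivative_eq_intros)
    from bounded_bilinear.has_vector_derivative[OF bounded_bilinear_matrix_mult this deriv[of 0]]
    have "(Q has_vector_derivative C + C) (at 0)"
      unfolding Q_def by (simp add: B0)
    then show ?thesis by (simp add: C_def scaleR_2[symmetric] flip: scaleR_add_left)
  qed
  ultimately show ?thesis using that by blast
qed


section \<open>The tangent spaces of the Grassmannian\<close>

text \<open>The linearization at \<open>P\<close> of the equations \<open>transpose P = P\<close>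
  and \<open>P ** P = P\<close>. For a projector \<open>P\<close> these are the symmetric matrices
  whose two diagonal blocks, with respect to the range and the kernel of \<open>P\<close>,
  vanish.\<close>

definition grassmann_tangent :: "real^'n^'n \<Rightarrow> (real^'n^'n) set" where
  "grassmann_tangent P = {v. transpose v = v \<and> P ** v + v ** P = v}"

text \<open>For a projector this is the expansion of P Z (1 - P) + (1 - P) Z P, the off-diagonal
  part of \<open>Z\<close>. No symmetry of \<open>Z\<close> is built in, so that it also applies to
  skew matrices when horizontal vectors are identified.\<close>

definition tangent_projection :: "real^'n^'n \<Rightarrow> real^'n^'n \<Rightarrow> real^'n^'n" where
  "tangent_projection P Z = P ** Z + Z ** P - 2 *\<^sub>R (P ** Z ** P)"

lemma grassmannianD:
  assumes "P \<in> grassmannian q"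
  shows "P ** P = P" and "transpose P = P" and "rank P = q" and "A ** P ** P = A ** P"
  using assms by (auto simp: grassmannian_def matrix_mul_assoc[symmetric])

lemma idempotent_mult_off_diagonal:
  fixes P v :: "real^'n^'n"
  assumes "P ** P = P" and "P ** v + v ** P = v"
  shows "P ** v ** P = 0"
proof -
  have "P ** (P ** v + v ** P) = P ** v"
    by (simp add: assms(2))
  then show ?thesis
    by (simp add: matrix_mult_distribs matrix_mul_assoc assms(1))
qed

lemma tangent_projection_eq_commutator:
  assumes "P ** P = P"
  shows "tangent_projection P Z = commutator (commutator Z P) P"
proof -
  have "Z ** P ** P = Z ** P"
    by (simp add: assms matrix_mul_assoc[symmetric])
  then show ?thesis
    by (simp add: tangent_projection_def commutator_def matrix_mult_distribs matrix_mul_assoc assms scaleR_2)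
qed

lemma tangent_projection_off_diagonal:
  assumes "P ** P = P"
  shows "P ** tangent_projection P Z + tangent_projection P Z ** P = tangent_projection P Z"
proof -
  have "A ** P ** P = A ** P" for A :: "real^'a^'a"
    using assms by (simp add: matrix_mul_assoc[symmetric])
  then show ?thesis
    by (simp add: tangent_projection_def matrix_mult_distribs matrix_mul_assoc assms)
      (simp add: vec_eq_iff)
qed

lemma tangent_projection_mem:
  assumes "P ** P = P" and "transpose P = P" and "transpose Z = Z"
  shows "tangent_projection P Z \<in> grassmann_tangent P"
  using tangent_projection_off_diagonal[OF assms(1)] assms
  by (simp add: grassmann_tangent_def)
    (simp add: tangent_projection_def transpose_distribs matrix_mul_assoc)

lemma tangent_projection_id:
  assumes "P ** P = P" and "v \<in> grassmann_tangent P"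
  shows "tangent_projection P v = v"
  using idempotent_mult_off_diagonal[of P v] assms
  by (simp add: tangent_projection_def grassmann_tangent_def)

text \<open>For symmetric \<open>P\<close> the map is self-adjoint, and it fixes
  \<open>v\<close>.\<close>

lemma inner_tangent_projection:
  assumes "P ** P = P" and "transpose P = P" and "v \<in> grassmann_tangent P"
  shows "tangent_projection P Z \<bullet> v = Z \<bullet> v"
proof -
  have "tangent_projection P Z \<bullet> v = Z \<bullet> tangent_projection P v"
    by (simp add: tangent_projection_def inner_add_left inner_add_right inner_diff_left inner_diff_right
        inner_matrix_mult_left[of P] inner_matrix_mult_right[of _ P] assms(2) matrix_mul_assoc)
  then show ?thesis by (simp add: tangent_projection_id[OF assms(1,3)])
qed

lemma bounded_linear_tangent_projection: "bounded_linear (tangent_projection P)"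
  unfolding tangent_projection_def
  by (intro linear_conv_bounded_linear[THEN iffD1] linearI)
    (auto simp: matrix_mult_distribs algebra_simps)

lemma smooth_tangent_projection: "smooth_on UNIV (\<lambda>P. tangent_projection P Z)"
proof -
  have "Ck_on k UNIV (\<lambda>P. P ** Z + Z ** P + (-2) *\<^sub>R (P ** Z ** P))" for k
    by (intro Ck_on_add Ck_on_bounded_bilinear[OF _ bounded_bilinear_matrix_mult]
        Ck_on_bounded_linear[OF _ bounded_linear_scaleR_right] Ck_on_id Ck_on_const) auto
  then show ?thesis by (simp add: smooth_on_def tangent_projection_def)
qed

text \<open>A product of two off-diagonal matrices is block diagonal and therefore commutes with
  \<open>P\<close>.\<close>

lemma commutator_commutes_tangent:
  assumes "P ** P = P" and "u \<in> grassmann_tangent P" and "v \<in> grassmann_tangent P"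
  shows "commutator (commutator u v) P = 0"
proof -
  have u: "u = P ** u + u ** P" and v: "v = P ** v + v ** P"
    using assms by (simp_all add: grassmann_tangent_def)
  \<comment> \<open>Both sides equal ab - aPb: substitute bP = b - Pb on the left and Pa = a - aP on
    the right.\<close>
  have swap: "a ** b ** P = P ** a ** b"
    if "P ** a + a ** P = a" "P ** b + b ** P = b" for a b :: "real^'a^'a"
  proof -
    have "b ** P = b - P ** b" "P ** a = a - a ** P"
      using that by (metis add_diff_cancel_left' add_diff_cancel_right')+
    then show ?thesis
      by (simp add: matrix_mul_assoc[symmetric] matrix_mult_diff_right)
        (simp add: matrix_mul_assoc matrix_mult_diff_left)
  qed
  show ?thesis
    using swap[OF u[symmetric] v[symmetric]] swap[OF v[symmetric] u[symmetric]]
    by (simp add: commutator_def matrix_mult_distribs matrix_mul_assoc)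
qed

lemma has_vector_derivative_unique_eventually:
  assumes "(f has_vector_derivative a) (at x)" and "(g has_vector_derivative b) (at x)"
    and "eventually (\<lambda>t. f t = g t) (nhds x)"
  shows "a = b"
proof -
  have "(g has_vector_derivative a) (at x)"
    using assms(1,3) unfolding has_vector_derivative_def
    by (auto elim!: has_derivative_transform_eventually simp: eventually_at_filter eventually_mono
        dest: eventually_nhds_x_imp_x)
  from vector_derivative_unique_at[OF this assms(2)] show ?thesis .
qed

text \<open>One inclusion differentiates the defining equations along a curve. For the other,
  \<open>P\<close> is conjugated by an orthogonal curve with velocity \<open>commutator v P\<close>
  at the identity; the velocity of the conjugates is the double commutator of \<open>v\<close> with
  \<open>P\<close>, which is \<open>v\<close>.\<close>

lemma tangent_space_grassmannian:
  assumes "P \<in> grassmannian q"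
  shows "tangent_space (grassmannian q) P = grassmann_tangent P"
proof (intro equalityI subsetI)
  fix v assume "v \<in> tangent_space (grassmannian q) P"
  then obtain c where "curve_through (grassmannian q) P v c"
    by (auto simp: tangent_space_def)
  note c = curve_throughD[OF this]
  have "((\<lambda>t. transpose (c t)) has_vector_derivative transpose v) (at 0)"
    using bounded_linear.has_vector_derivative[OF bounded_linear_transpose c(2)] .
  then have "transpose v = v"
    by (rule has_vector_derivative_unique_eventually[OF _ c(2)])
      (use c(3) in \<open>eventually_elim, simp add: grassmannianD\<close>)
  moreover have "((\<lambda>t. c t ** c t) has_vector_derivative P ** v + v ** P) (at 0)"
    using bounded_bilinear.has_vector_derivative[OF bounded_bilinear_matrix_mult c(2) c(2)] c(1) by simp
  then have "P ** v + v ** P = v"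
    by (rule has_vector_derivative_unique_eventually[OF _ c(2)])
      (use c(3) in \<open>eventually_elim, simp add: grassmannianD\<close>)
  ultimately show "v \<in> grassmann_tangent P"
    by (simp add: grassmann_tangent_def)
next
  fix v assume v: "v \<in> grassmann_tangent P"
  note P = grassmannianD[OF assms]
  have "transpose (commutator v P) = - commutator v P"
    using v by (simp add: commutator_def transpose_distribs P grassmann_tangent_def)
  then obtain Q where Q: "smooth_on UNIV Q" "\<And>t. orthogonal_matrix (Q t)"
    "Q 0 = mat 1" "(Q has_vector_derivative commutator v P) (at (0::real))"
    using orthogonal_curve_with_velocity by blast
  define c where "c t = Q t ** P ** transpose (Q t)" for t
  have "smooth_on UNIV c"
    using Q(1) unfolding c_def smooth_on_def
    by (intro allI Ck_on_bounded_bilinear[OF _ bounded_bilinear_matrix_mult] Ck_on_const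
        Ck_on_bounded_linear[OF _ bounded_linear_transpose]) auto
  moreover have "c t \<in> grassmannian q" for t
  proof -
    have "c t ** c t = Q t ** (P ** (transpose (Q t) ** Q t) ** P) ** transpose (Q t)"
      by (simp add: c_def matrix_mul_assoc)
    also have "\<dots> = c t"
      by (simp add: c_def orthogonal_matrixD[OF Q(2)] P)
    finally have "c t ** c t = c t" .
    then show ?thesis
      by (simp add: grassmannian_def)
        (simp add: c_def rank_orthogonal_conjugate[OF Q(2)] P transpose_distribs matrix_mul_assoc)
  qed
  moreover have "c 0 = P" by (simp add: c_def Q)
  moreover have "(c has_vector_derivative v) (at 0)"
  proof -
    have "((\<lambda>t. Q t ** P) has_vector_derivative commutator v P ** P) (at 0)"
      using bounded_bilinear.has_vector_derivative[OF bounded_bilinear_matrix_mult Q(4) has_vector_derivative_const[of P]]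
      by simp
    from bounded_bilinear.has_vector_derivative[OF bounded_bilinear_matrix_mult this
        bounded_linear.has_vector_derivative[OF bounded_linear_transpose Q(4)]]
    have "(c has_vector_derivative P ** transpose (commutator v P) + commutator v P ** P) (at 0)"
      by (simp add: c_def[abs_def] Q)
    also have "P ** transpose (commutator v P) + commutator v P ** P = tangent_projection P v"
      using v
      by (simp add: P commutator_def tangent_projection_def grassmann_tangent_def transpose_distribs
          matrix_mult_distribs matrix_mul_assoc scaleR_2)
    also have "\<dots> = v" using tangent_projection_id[OF P(1) v] .
    finally show ?thesis .
  qed
  ultimately have "curve_through (grassmannian q) P v c"
    unfolding curve_through_def by (auto intro: smooth_on_subset intro!: exI[of _ 1])
  then show "v \<in> tangent_space (grassmannian q) P"
    by (auto simp: tangent_space_def)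
qed


section \<open>The quotient metric\<close>

text \<open>\<open>V\<close> is the block diagonal part P W P + (1 - P) W (1 - P) of
  \<open>W\<close>. It is the vertical vector against which horizontality of \<open>W\<close> is
  tested later.\<close>

lemma diagonal_block_skew:
  fixes P W :: "real^'n^'n"
  assumes "P ** P = P" and "transpose P = P" and "W \<in> so_algebra"
  defines "V \<equiv> W - (P ** W + W ** P) + 2 *\<^sub>R (P ** W ** P)"
  shows "V \<in> so_algebra" and "P ** V = V ** P" and "V \<bullet> V = W \<bullet> V"
proof -
  have PP: "A ** P ** P = A ** P" for A :: "real^'n^'n"
    using assms(1) by (simp add: matrix_mul_assoc[symmetric])
  have W: "transpose W = - W"
    using assms(3) by (simp add: so_algebra_def)
  show "V \<in> so_algebra"
    using W by (simp add: so_algebra_def V_def transpose_distribs assms matrix_mult_distribs matrix_mul_assoc)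
  show comm: "P ** V = V ** P"
    by (simp add: V_def matrix_mult_distribs matrix_mul_assoc assms(1) PP)
  \<comment> \<open>Taking off-diagonal parts is self-adjoint and annihilates \<open>V\<close>,
    which commutes with \<open>P\<close>. Hence \<open>W - V\<close> is orthogonal to
    \<open>V\<close>.\<close>
  have "(P ** W + W ** P - 2 *\<^sub>R (P ** W ** P)) \<bullet> V =
      W \<bullet> (P ** V + V ** P - 2 *\<^sub>R (P ** V ** P))"
    by (simp add: inner_add_left inner_add_right inner_diff_left inner_diff_right
        inner_matrix_mult_left[of P] inner_matrix_mult_right[of _ P] assms(2) matrix_mul_assoc)
  also have "P ** V + V ** P - 2 *\<^sub>R (P ** V ** P) = 0"
    by (simp add: comm PP scaleR_2)
  finally have "(P ** W + W ** P - 2 *\<^sub>R (P ** W ** P)) \<bullet> V = 0"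
    by simp
  moreover have "P ** W + W ** P - 2 *\<^sub>R (P ** W ** P) = W - V"
    by (simp add: V_def algebra_simps)
  ultimately have "(W - V) \<bullet> V = 0"
    by simp
  then show "V \<bullet> V = W \<bullet> V"
    by (simp add: inner_diff_left)
qed

lemma inner_commutator_projection:
  fixes P A B :: "real^'n^'n"
  assumes "transpose P = P"
  shows "commutator A P \<bullet> B = A \<bullet> commutator B P"
  by (simp add: commutator_def inner_diff_left inner_diff_right inner_matrix_mult_left[of P]
      inner_matrix_mult_right[of _ P] assms)

lemma metric_SO_left_translate:
  assumes "orthogonal_matrix Q"
  shows "metric_SO Q (Q ** V) (Q ** W) = V \<bullet> W / 2"
  by (simp add: metric_SO_def orthogonal_matrixD[OF assms] trace_transpose_mult)

section \<open>The base point and its vertical and horizontal spaces\<close>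

lemma P0_mult_vector: "(P0 q *v x) $ i = (if card {k. k < i} < q then x $ i else 0)"
  by (simp add: P0_def matrix_vector_mult_def if_distrib[of "\<lambda>x. x * _"] cong: if_cong)

lemma P0_idempotent: "P0 q ** P0 q = P0 q"
  by (simp add: matrix_eq matrix_vector_mul_assoc[symmetric] vec_eq_iff P0_mult_vector)

lemma transpose_P0: "transpose (P0 q) = P0 q"
  by (auto simp: P0_def transpose_def vec_eq_iff)

text \<open>The orbit map is quadratic on the whole matrix space, so its ambient derivative exists
  at every \<open>Q\<close> and comes from the product rule.\<close>

lemma orbit_map_deriv_eq:
  "orbit_map_deriv q Q U = U ** P0 q ** transpose Q + Q ** P0 q ** transpose U"
proof -
  have "((\<lambda>Q. Q ** P0 q) has_derivative (\<lambda>U. U ** P0 q)) (at Q)"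
    using bounded_bilinear.FDERIV[OF bounded_bilinear_matrix_mult has_derivative_ident has_derivative_const[of "P0 q"]]
    by simp
  from bounded_bilinear.FDERIV[OF bounded_bilinear_matrix_mult this
      bounded_linear.has_derivative[OF bounded_linear_transpose has_derivative_ident]]
  have "(orbit_map q has_derivative (\<lambda>U. Q ** P0 q ** transpose U + U ** P0 q ** transpose Q)) (at Q)"
    by (simp add: orbit_map_def[abs_def])
  from fun_cong[OF frechet_derivative_at[OF this], of U] show ?thesis
    by (simp add: add.commute)
qed

lemma orbit_map_deriv_left_translate:
  assumes "W \<in> so_algebra"
  shows "orbit_map_deriv q Q (Q ** W) = Q ** commutator W (P0 q) ** transpose Q"
  using assms
  by (simp add: orbit_map_deriv_eq so_algebra_def commutator_def matrix_mult_distribs transpose_distribs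
      matrix_mul_assoc)

lemma vertical_space_iff:
  assumes "orthogonal_matrix Q" and "W \<in> so_algebra"
  shows "Q ** W \<in> vertical_space q Q \<longleftrightarrow> commutator W (P0 q) = 0"
proof -
  have "Q ** A ** transpose Q = 0 \<longleftrightarrow> A = 0" for A
    using orthogonal_matrixD[OF assms(1)] by (metis matrix_mul_assoc times0_left times0_right)
  then show ?thesis
    using assms(2) by (auto simp: vertical_space_def tangent_SO_def orbit_map_deriv_left_translate)
qed

text \<open>The block diagonal part \<open>V\<close> of \<open>W\<close> is vertical after left
  translation, so horizontality gives W . V = 0. Since V . V = W . V, it follows that V = 0:
  \<open>W\<close> is off-diagonal and hence fixed by the double commutator.\<close>

lemma horizontal_spaceE:
  assumes "orthogonal_matrix Q" and "U \<in> horizontal_space q Q"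
  obtains W where "U = Q ** W" and "W \<in> so_algebra" and "commutator (commutator W (P0 q)) (P0 q) = W"
proof -
  from assms(2) obtain W where W: "U = Q ** W" "W \<in> so_algebra"
    by (auto simp: horizontal_space_def tangent_SO_def)
  define V where "V = W - (P0 q ** W + W ** P0 q) + 2 *\<^sub>R (P0 q ** W ** P0 q)"
  note V = diagonal_block_skew[OF P0_idempotent transpose_P0 W(2), of q, folded V_def]
  have "Q ** V \<in> vertical_space q Q"
    using V by (simp add: vertical_space_iff[OF assms(1)] commutator_def)
  then have "metric_SO Q (Q ** W) (Q ** V) = 0"
    using assms(2) W(1) by (auto simp: horizontal_space_def)
  then have "V = 0"
    using V(3) by (simp add: metric_SO_left_translate[OF assms(1)])
  then have "tangent_projection (P0 q) W = W"
    unfolding V_def tangent_projection_def by (simp add: algebra_simps)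
  with W that show ?thesis
    by (simp add: tangent_projection_eq_commutator[OF P0_idempotent])
qed

text \<open>Symmetry of \<open>w\<close> makes the commutator skew. Against a vertical
  \<open>Q ** W\<close>, self-adjointness moves the bracket with \<open>P0 q\<close> onto
  \<open>W\<close>, where it vanishes.\<close>

lemma horizontal_spaceI:
  assumes "orthogonal_matrix Q" and "transpose w = w"
  shows "Q ** commutator w (P0 q) \<in> horizontal_space q Q"
proof -
  have skew: "commutator w (P0 q) \<in> so_algebra"
    by (simp add: so_algebra_def commutator_def transpose_distribs assms(2) transpose_P0)
  have "metric_SO Q (Q ** commutator w (P0 q)) V = 0" if V: "V \<in> vertical_space q Q" for V
  proof -
    obtain W where W: "V = Q ** W" "W \<in> so_algebra"
      using V by (auto simp: vertical_space_def tangent_SO_def)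
    then have "commutator W (P0 q) = 0"
      using V vertical_space_iff[OF assms(1)] by blast
    then show ?thesis
      by (simp add: W metric_SO_left_translate[OF assms(1)] inner_commutator_projection[OF transpose_P0])
  qed
  with skew show ?thesis by (auto simp: horizontal_space_def tangent_SO_def)
qed

section \<open>Transitivity of the special orthogonal group on the Grassmannian\<close>

lemma card_P0_indices:
  assumes "q \<le> CARD('n::{finite,linorder})"
  shows "card {i::'n. card {k. k < i} < q} = q"
proof -
  let ?r = "\<lambda>i::'n. card {k. k < i}"
  have mono: "?r i < ?r j" if "i < j" for i j
    using that by (intro psubset_card_mono) auto
  then have inj: "inj ?r"
    by (intro linorder_injI) (metis less_irrefl)
  have "?r i < CARD('n)" for i
    by (intro psubset_card_mono) auto
  \<comment> \<open>Counting predecessors is injective into a set of the same finite cardinality,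
    hence onto it; it numbers the indices from 0.\<close>
  then have "range ?r = {..<CARD('n)}"
    using card_image[OF inj] by (intro card_subset_eq) auto
  then have "?r ` {i. ?r i < q} = {..<q}"
    using assms by (auto simp: set_eq_iff image_iff) (metis (mono_tags) lessThan_iff order_less_le_trans rangeE)
  then show ?thesis
    using card_image[OF inj_on_subset[OF inj subset_UNIV], of "{i. ?r i < q}"] by simp
qed

lemma rank_P0:
  assumes "q \<le> CARD('n)"
  shows "rank (P0 q :: 'n::{finite,linorder} sq_matrix) = q"
proof -
  have "range ((*v) (P0 q :: 'n sq_matrix)) = {x. \<forall>i. i \<notin> {i. card {k. k < i} < q} \<longrightarrow> x $ i = 0}"
    by (auto simp: P0_mult_vector vec_eq_iff image_iff)
  then show ?thesis
    using assms dim_substandard_cart[of "{i::'n. card {k. k < i} < q}", where 'a = real]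
    by (simp only: rank_dim_range dim_vec_eq card_P0_indices)
qed

text \<open>The ranges of P and 1 - P are orthogonal and together span the space, so their
  dimensions add up.\<close>

lemma projection_ranges:
  fixes P :: "real^'n^'n"
  assumes "P ** P = P" and "transpose P = P"
  shows "dim (range ((*v) (mat 1 - P))) + rank P = CARD('n)"
    and "orthogonal (P *v x) (y - P *v y)"
proof -
  show orth: "orthogonal (P *v x) (y - P *v y)" for x y
  proof -
    have "(P *v x) \<bullet> z = x \<bullet> (P *v z)" for z
      using dot_lmul_matrix[of x P z] assms(2) by (metis transpose_matrix_vector)
    then show ?thesis
      by (simp add: orthogonal_def matrix_vector_mult_diff_distrib matrix_vector_mul_assoc assms(1))
  qed
  have "dim (range ((*v) P) \<union> range ((*v) (mat 1 - P))) = rank P + dim (range ((*v) (mat 1 - P)))"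
    unfolding rank_dim_range using orth
    by (intro dim_orthogonal_sum) (auto simp: matrix_vector_mult_diff_rdistrib orthogonal_def)
  moreover have "span (range ((*v) P) \<union> range ((*v) (mat 1 - P))) = UNIV"
  proof -
    have "x \<in> span (range ((*v) P) \<union> range ((*v) (mat 1 - P)))" for x
    proof -
      have "x = P *v x + (mat 1 - P) *v x"
        by (simp add: matrix_vector_mult_diff_rdistrib)
      then show ?thesis by (metis span_add span_base UnI1 UnI2 rangeI)
    qed
    then show ?thesis by blast
  qed
  ultimately show "dim (range ((*v) (mat 1 - P))) + rank P = CARD('n)"
    by (metis add.commute dim_UNIV DIM_cart DIM_real dim_span mult.right_neutral)
qed

text \<open>Equal ranks give a linear isometry between the ranges of \<open>P\<close> and
  \<open>R\<close> and, by complementary dimensions, one between their orthogonal complements. Glued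
  together they form an orthogonal map that intertwines the two projections.\<close>

lemma projections_conjugate:
  fixes P R :: "real^'n^'n"
  assumes P: "P ** P = P" "transpose P = P" and R: "R ** R = R" "transpose R = R" and "rank P = rank R"
  obtains Q where "orthogonal_matrix Q" and "Q ** P ** transpose Q = R"
proof -
  let ?P' = "mat 1 - P" and ?R' = "mat 1 - R"
  have subsp: "subspace (range ((*v) A))" for A :: "real^'n^'n"
    by (intro linear_subspace_image subspace_UNIV matrix_vector_mul_linear)
  obtain f where f: "linear f" "f ` range ((*v) P) = range ((*v) R)" "\<And>x. x \<in> range ((*v) P) \<Longrightarrow> norm (f x) = norm x"
    using isometries_subspaces[OF subsp subsp, of P R] assms(5) unfolding rank_dim_range by metis
  have "dim (range ((*v) ?P')) = dim (range ((*v) ?R'))"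
    using projection_ranges(1)[OF P] projection_ranges(1)[OF R] assms(5) by linarith
  then obtain g where g: "linear g" "g ` range ((*v) ?P') = range ((*v) ?R')" "\<And>x. x \<in> range ((*v) ?P') \<Longrightarrow> norm (g x) = norm x"
    using isometries_subspaces[OF subsp subsp, of ?P' ?R'] by metis
  define h where "h x = f (P *v x) + g (x - P *v x)" for x
  have "linear h"
    unfolding h_def
    by (intro linear_compose_add linear_compose[OF _ f(1), unfolded o_def] linear_compose[OF _ g(1), unfolded o_def]
        linear_compose_sub linear_id matrix_vector_mul_linear linear_ident)
  have fP: "\<exists>y. f (P *v x) = R *v y" for x
    using f(2) by (metis imageE image_eqI rangeI)
  have gP: "\<exists>y. g (x - P *v x) = y - R *v y" for x
  proof -
    have "x - P *v x \<in> range ((*v) ?P')"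
      by (auto simp: matrix_vector_mult_diff_rdistrib)
    then obtain y where "g (x - P *v x) = ?R' *v y"
      using g(2) by blast
    then show ?thesis by (auto simp: matrix_vector_mult_diff_rdistrib)
  qed
  \<comment> \<open>\<open>R\<close> fixes the component coming from \<open>f\<close> and
    annihilates the one coming from \<open>g\<close>.\<close>
  have Rh: "R *v h x = f (P *v x)" for x
    using fP[of x] gP[of x]
    by (auto simp: h_def matrix_vector_right_distrib matrix_vector_mult_diff_distrib matrix_vector_mul_assoc R)
  have hP: "h (P *v x) = f (P *v x)" for x
    by (simp add: h_def matrix_vector_mul_assoc P linear_0[OF g(1)])
  have "norm (h x) = norm x" for x
  proof -
    have "orthogonal (f (P *v x)) (g (x - P *v x))"
      using fP[of x] gP[of x] projection_ranges(2)[OF R] by metis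
    then have "(norm (h x))\<^sup>2 = (norm (f (P *v x)))\<^sup>2 + (norm (g (x - P *v x)))\<^sup>2"
      unfolding h_def by (rule norm_add_Pythagorean)
    also have "\<dots> = (norm (P *v x))\<^sup>2 + (norm (x - P *v x))\<^sup>2"
      using f(3)[of "P *v x"] g(3)[of "?P' *v x"] by (simp add: matrix_vector_mult_diff_rdistrib)
    also have "\<dots> = (norm (P *v x + (x - P *v x)))\<^sup>2"
      by (rule norm_add_Pythagorean[symmetric]) (rule projection_ranges(2)[OF P])
    finally show ?thesis by simp
  qed
  then have "orthogonal_transformation h"
    using \<open>linear h\<close> by (simp add: orthogonal_transformation)
  then have Q: "orthogonal_matrix (matrix h)"
    by (simp add: orthogonal_transformation_matrix)
  have "R ** matrix h = matrix h ** P"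
    unfolding matrix_eq
    by (simp add: matrix_vector_mul_assoc[symmetric] fun_cong[OF matrix_vector_mul(2)[OF \<open>linear h\<close>]] Rh hP)
  then have "matrix h ** P ** transpose (matrix h) = R"
    using orthogonal_matrixD(6)[OF Q, of R] by simp
  with Q that show ?thesis by blast
qed

text \<open>Orthogonal conjugacy of projectors provides \<open>Q\<close> up to the sign of its
  determinant, which is corrected inside the stabilizer of \<open>P0 q\<close>.\<close>

lemma grassmannian_orbit:
  fixes P :: "'n::{finite,linorder} sq_matrix"
  assumes "P \<in> grassmannian q" and "q \<le> CARD('n)"
  obtains Q where "Q \<in> special_orthogonal" and "orbit_map q Q = P"
proof -
  obtain Q where Q: "orthogonal_matrix Q" "Q ** P0 q ** transpose Q = P"
    using projections_conjugate[OF P0_idempotent transpose_P0 grassmannianD(1,2)[OF assms(1)]]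
      rank_P0[OF assms(2)] grassmannianD(3)[OF assms(1)] by metis
  show ?thesis
  proof (cases "det Q = 1")
    case True
    with Q that show ?thesis by (simp add: special_orthogonal_def orbit_map_def)
  next
    case False
    then have "det Q = -1" using det_orthogonal_matrix[OF Q(1)] by blast
    fix m :: 'n
    \<comment> \<open>Changing the sign of one column leaves the orbit point fixed since the sign matrix is diagonal like \<open>P0 q\<close>.\<close>
    define D :: "'n sq_matrix" where "D = (\<chi> i j. if i = j then (if i = m then -1 else 1) else 0)"
    have "det D = (\<Prod>i\<in>UNIV. if i = m then -1 else 1)"
      by (subst det_diagonal) (auto simp: D_def)
    then have det: "det D = -1" by (simp add: prod.delta)
    have Dv: "(D *v x) $ i = (if i = m then - x $ i else x $ i)" for x i
      by (simp add: D_def matrix_vector_mult_def if_distrib[of "\<lambda>x. x * _"] cong: if_cong)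
    have DD: "D ** D = mat 1"
      by (simp add: matrix_eq matrix_vector_mul_assoc[symmetric] vec_eq_iff Dv)
    have tD: "transpose D = D"
      by (auto simp: D_def transpose_def vec_eq_iff)
    have DP: "D ** P0 q = P0 q ** D"
      by (simp add: matrix_eq matrix_vector_mul_assoc[symmetric] vec_eq_iff Dv P0_mult_vector)
    have "orthogonal_matrix (Q ** D)"
      using Q(1) DD tD by (intro orthogonal_matrix_mul) (auto simp: orthogonal_matrix)
    moreover have "det (Q ** D) = 1"
      by (simp add: det_mul det \<open>det Q = -1\<close>)
    moreover have "orbit_map q (Q ** D) = Q ** (D ** P0 q ** D) ** transpose Q"
      by (simp add: orbit_map_def transpose_distribs tD matrix_mul_assoc)
    moreover have "D ** P0 q ** D = P0 q"
      by (simp add: DP) (simp add: matrix_mul_assoc[symmetric] DD)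
    ultimately show ?thesis
      using Q(2) that by (simp add: special_orthogonal_def)
  qed
qed

text \<open>The definite description requires that horizontal lifts exist at some point of the fibre
  and that every choice of point and lifts gives the same number.\<close>

lemma grassmann_metric_eq:
  fixes P :: "'n::{finite,linorder} sq_matrix"
  assumes P: "P \<in> grassmannian q" and q: "q \<le> CARD('n)"
    and "u \<in> grassmann_tangent P" and "v \<in> grassmann_tangent P"
  shows "grassmann_metric q P u v = u \<bullet> v / 2"
  unfolding grassmann_metric_def
proof (rule the_equality)
  obtain Q where Q: "Q \<in> special_orthogonal" "orbit_map q Q = P"
    using grassmannian_orbit[OF P q] .
  then have orth: "orthogonal_matrix Q" and QP: "Q ** P0 q ** transpose Q = P"
    by (auto simp: special_orthogonal_def orbit_map_def)
  \<comment> \<open>Equal to the conjugate of \<open>commutator u P\<close> by \<open>Q\<close>; the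
    orbit map sends its left translate to the double commutator of \<open>u\<close> with
    \<open>P\<close>, that is to \<open>u\<close>.\<close>
  define lift where "lift u = commutator (transpose Q ** u ** Q) (P0 q)" for u
  have lift: "Q ** lift u \<in> horizontal_space q Q" "orbit_map_deriv q Q (Q ** lift u) = u"
    "lift u = transpose Q ** commutator u P ** Q"
    if "u \<in> grassmann_tangent P" for u
  proof -
    let ?w = "transpose Q ** u ** Q"
    have w: "transpose ?w = ?w"
      using that by (simp add: grassmann_tangent_def transpose_distribs matrix_mul_assoc)
    show "Q ** lift u \<in> horizontal_space q Q"
      unfolding lift_def by (rule horizontal_spaceI[OF orth w])
    show lift_eq: "lift u = transpose Q ** commutator u P ** Q"
      unfolding QP[symmetric] lift_def
      by (simp add: commutator_def matrix_mult_distribs matrix_mul_assoc orthogonal_matrixD[OF orth])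
    have "lift u \<in> so_algebra"
      using w by (simp add: so_algebra_def lift_def commutator_def transpose_distribs transpose_P0)
    then have "orbit_map_deriv q Q (Q ** lift u) = Q ** commutator (lift u) (P0 q) ** transpose Q"
      by (rule orbit_map_deriv_left_translate)
    also have "\<dots> = commutator (Q ** lift u ** transpose Q) P"
      unfolding QP[symmetric]
      by (simp add: commutator_def matrix_mult_distribs matrix_mul_assoc orthogonal_matrixD[OF orth])
    also have "\<dots> = commutator (commutator u P) P"
      by (simp add: lift_eq matrix_mul_assoc orthogonal_matrixD[OF orth])
    also have "\<dots> = u"
      using tangent_projection_eq_commutator[OF grassmannianD(1)[OF P]]
        tangent_projection_id[OF grassmannianD(1)[OF P] that] by metis
    finally show "orbit_map_deriv q Q (Q ** lift u) = u" .
  qed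
  \<comment> \<open>Conjugation by \<open>Q\<close> is an isometry, and moving one bracket across
    the inner product produces a double commutator that fixes \<open>B\<close>.\<close>
  have uniq: "r = u \<bullet> v / 2"
    if H: "Q \<in> special_orthogonal \<and> orbit_map q Q = P \<and> U \<in> horizontal_space q Q \<and> V \<in> horizontal_space q Q \<and>
        orbit_map_deriv q Q U = u \<and> orbit_map_deriv q Q V = v \<and> r = metric_SO Q U V" for r Q U V
  proof -
    have orth: "orthogonal_matrix Q" using H by (simp add: special_orthogonal_def)
    obtain A where A: "U = Q ** A" "A \<in> so_algebra" "commutator (commutator A (P0 q)) (P0 q) = A"
      using H horizontal_spaceE[OF orth] by metis
    obtain B where B: "V = Q ** B" "B \<in> so_algebra" "commutator (commutator B (P0 q)) (P0 q) = B"
      using H horizontal_spaceE[OF orth] by metis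
    have "u \<bullet> v = (Q ** commutator A (P0 q) ** transpose Q) \<bullet> (Q ** commutator B (P0 q) ** transpose Q)"
      using H A B by (auto simp: orbit_map_deriv_left_translate)
    also have "\<dots> = commutator A (P0 q) \<bullet> commutator B (P0 q)"
      by (rule inner_orthogonal_conjugate[OF orth])
    also have "\<dots> = A \<bullet> B"
      by (simp add: inner_commutator_projection[OF transpose_P0] B)
    finally show ?thesis
      using H A B by (simp add: metric_SO_left_translate[OF orth])
  qed
  show "\<exists>Q U V. Q \<in> special_orthogonal \<and> orbit_map q Q = P \<and>
      U \<in> horizontal_space q Q \<and> V \<in> horizontal_space q Q \<and>
      orbit_map_deriv q Q U = u \<and> orbit_map_deriv q Q V = v \<and> u \<bullet> v / 2 = metric_SO Q U V"
  proof -
    \<comment> \<open>The lifts are first entered with their own metric value; \<open>uniq\<close>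
      then identifies that value.\<close>
    have "Q \<in> special_orthogonal \<and> orbit_map q Q = P \<and>
      Q ** lift u \<in> horizontal_space q Q \<and> Q ** lift v \<in> horizontal_space q Q \<and>
      orbit_map_deriv q Q (Q ** lift u) = u \<and> orbit_map_deriv q Q (Q ** lift v) = v \<and>
      metric_SO Q (Q ** lift u) (Q ** lift v) = metric_SO Q (Q ** lift u) (Q ** lift v)"
      using Q lift(1,2)[OF assms(3)] lift(1,2)[OF assms(4)] by simp
    with uniq[OF this] show ?thesis by metis
  qed
  show "r = u \<bullet> v / 2"
    if "\<exists>Q U V. Q \<in> special_orthogonal \<and> orbit_map q Q = P \<and>
      U \<in> horizontal_space q Q \<and> V \<in> horizontal_space q Q \<and>
      orbit_map_deriv q Q U = u \<and> orbit_map_deriv q Q V = v \<and> r = metric_SO Q U V" for r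
    using that uniq by blast
qed


section \<open>The Levi-Civita connection\<close>

text \<open>Projecting a constant symmetric matrix yields a global smooth field, so each tangent
  vector at a point extends to the whole Grassmannian.\<close>

lemma smooth_vector_field_tangent_projection:
  assumes "transpose Z = Z"
  shows "smooth_vector_field (grassmannian q) (\<lambda>P. tangent_projection P Z)"
  using assms
  by (auto simp: smooth_vector_field_def tangent_space_grassmannian grassmannianD
      intro!: smooth_map_of_smooth_on_UNIV smooth_tangent_projection tangent_projection_mem)

lemma tangent_deriv_linear_functional:
  assumes "v \<in> tangent_space M x"
  shows "tangent_deriv M (\<lambda>y. y \<bullet> e) x v = v \<bullet> e"
  using assms
  by (rule tangent_deriv_eq[where U = UNIV]) (auto intro!: derivative_eq_intros)

text \<open>The bracket is known through its action on functions. Testing it on the linear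
  functionals \<open>y \<bullet> e\<close> recovers its value as a matrix, because such a functional
  turns a field \<open>V\<close> into the function \<open>V y \<bullet> e\<close> on
  \<open>M\<close>.\<close>

lemma lie_bracket_eq:
  assumes "is_lie_bracket M X Y Z" and "smooth_vector_field M X" and "smooth_vector_field M Y" and "x \<in> M"
  shows "Z x = tangent_deriv M Y x (X x) - tangent_deriv M X x (Y x)"
proof (rule vector_eq_rdot[THEN iffD1], intro allI)
  fix e
  have functional: "smooth_map M (\<lambda>y. y \<bullet> e)"
    by (intro smooth_map_of_smooth_on_UNIV)
      (auto simp: smooth_on_def intro!: Ck_on_bounded_linear[OF _ bounded_linear_inner_left] Ck_on_id)
  have deriv: "tangent_deriv M (\<lambda>y. tangent_deriv M (\<lambda>y. y \<bullet> e) y (V y)) x (U x) = tangent_deriv M V x (U x) \<bullet> e"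
    if "smooth_vector_field M U" "smooth_vector_field M V" for U V
    using that assms(4)
    by (intro tangent_deriv_bounded_linear[OF bounded_linear_inner_left])
      (auto simp: smooth_vector_field_def tangent_deriv_linear_functional)
  have "Z x \<in> tangent_space M x"
    using assms(1,4) by (auto simp: is_lie_bracket_def smooth_vector_field_def)
  then have "Z x \<bullet> e = tangent_deriv M (\<lambda>y. y \<bullet> e) x (Z x)"
    by (simp add: tangent_deriv_linear_functional)
  also have "\<dots> = tangent_deriv M (\<lambda>y. tangent_deriv M (\<lambda>y. y \<bullet> e) y (Y y)) x (X x) -
      tangent_deriv M (\<lambda>y. tangent_deriv M (\<lambda>y. y \<bullet> e) y (X y)) x (Y x)"
    using assms(1,4) functional unfolding is_lie_bracket_def by blast
  finally show "Z x \<bullet> e = (tangent_deriv M Y x (X x) - tangent_deriv M X x (Y x)) \<bullet> e"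
    by (simp add: deriv assms(2,3) inner_diff_left)
qed

text \<open>
  The difference tensor \<open>S\<close> between \<open>nabla\<close> and the projected ambient derivative is symmetric in its
  two arguments, since both are torsion-free, and skew for the inner product in the last two, since both
  are metric; such a tensor vanishes.
\<close>

lemma levi_civita_grassmannian:
  fixes nabla :: "('n::{finite,linorder} sq_matrix \<Rightarrow> 'n sq_matrix) \<Rightarrow> ('n sq_matrix \<Rightarrow> 'n sq_matrix) \<Rightarrow> ('n sq_matrix \<Rightarrow> 'n sq_matrix)"
  assumes lc: "levi_civita (grassmannian q) (grassmann_metric q) nabla" and q: "q \<le> CARD('n)"
    and X: "smooth_vector_field (grassmannian q) X" and Y: "smooth_vector_field (grassmannian q) Y"
    and P: "P \<in> grassmannian q"
  shows "nabla X Y P = tangent_projection P (tangent_deriv (grassmannian q) Y P (X P))"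
proof -
  let ?M = "grassmannian q :: 'n sq_matrix set"
  let ?vf = "smooth_vector_field ?M"
  let ?tp = "tangent_projection P"
  interpret tp: bounded_linear ?tp by (rule bounded_linear_tangent_projection)
  define D where "D U V = tangent_deriv ?M V P (U P)" for U V :: "'n sq_matrix \<Rightarrow> 'n sq_matrix"
  define S where "S U V = nabla U V P - ?tp (D U V)" for U V
  note P' = grassmannianD(1,2)[OF P]
  have tangent: "U y \<in> grassmann_tangent y" if "?vf U" "y \<in> ?M" for U y
    using that by (auto simp: smooth_vector_field_def tangent_space_grassmannian)
  have vf: "?vf (nabla U V)" if "?vf U" "?vf V" for U V
    using lc that by (simp add: levi_civita_def affine_connection_def)
  have sym: "S U V = S V U" if "?vf U" "?vf V" for U V
  proof -
    have "is_lie_bracket ?M U V (\<lambda>x. nabla U V x - nabla V U x)"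
      using lc that by (simp add: levi_civita_def)
    then have "nabla U V P - nabla V U P = D U V - D V U"
      unfolding D_def using that P by (rule lie_bracket_eq)
    then have "?tp (nabla U V P) - ?tp (nabla V U P) = ?tp (D U V) - ?tp (D V U)"
      by (simp flip: tp.diff)
    then show ?thesis
      using vf that P tangent tangent_projection_id[OF P'(1)]
      by (simp add: S_def) (metis add_diff_eq diff_add_cancel diff_diff_eq2 add.commute)
  qed
  have half_inner: "bounded_bilinear (\<lambda>a b :: 'n sq_matrix. a \<bullet> b / 2)"
    unfolding bilinear_conv_bounded_bilinear[symmetric] bilinear_def
    by (auto intro!: linearI simp: inner_add_left inner_add_right add_divide_distrib)
  have skew: "S U V \<bullet> W P + V P \<bullet> S U W = 0" if "?vf U" "?vf V" "?vf W" for U V W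
  proof -
    have "tangent_deriv ?M (\<lambda>y. grassmann_metric q y (V y) (W y)) P (U P) =
        (V P \<bullet> D U W) / 2 + (D U V \<bullet> W P) / 2"
      unfolding D_def using that P
      by (intro tangent_deriv_bounded_bilinear[OF half_inner])
        (auto simp: smooth_vector_field_def grassmann_metric_eq q tangent_space_grassmannian)
    moreover have "tangent_deriv ?M (\<lambda>y. grassmann_metric q y (V y) (W y)) P (U P) =
        grassmann_metric q P (nabla U V P) (W P) + grassmann_metric q P (V P) (nabla U W P)"
      using lc that P by (simp add: levi_civita_def)
    ultimately have "V P \<bullet> D U W + D U V \<bullet> W P = nabla U V P \<bullet> W P + V P \<bullet> nabla U W P"
      using that P by (simp add: grassmann_metric_eq q tangent vf)
    \<comment> \<open>The other factor of each inner product is tangent, so the normal component of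
      the ambient derivative contributes nothing.\<close>
    moreover have "V P \<bullet> D U W = V P \<bullet> ?tp (D U W)" "D U V \<bullet> W P = ?tp (D U V) \<bullet> W P"
      using inner_tangent_projection[OF P'] tangent that P by (metis inner_commute)+
    ultimately show ?thesis
      by (simp add: S_def inner_diff_left inner_diff_right)
  qed
  \<comment> \<open>Write T(U,V,W) for \<open>S U V \<bullet> W P\<close>. Alternating skewness in
    the last two slots with symmetry in the first two gives T(X,Y,W) = -T(X,W,Y) = -T(W,X,Y) =
    T(W,Y,X) = T(Y,W,X) = -T(Y,X,W) = -T(X,Y,W).\<close>
  have orth: "S X Y \<bullet> W P = 0" if W: "?vf W" for W
    using skew[OF X Y W] skew[OF W X Y] skew[OF Y W X] sym[OF X Y] sym[OF X W] sym[OF Y W]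
    by (simp add: inner_commute)
  \<comment> \<open>Extends the tangent vector \<open>S X Y\<close> to a field with that value at
    \<open>P\<close>; testing against it makes \<open>S X Y\<close> orthogonal to itself.\<close>
  define W where "W Z = tangent_projection Z (S X Y)" for Z
  have "nabla X Y P \<in> grassmann_tangent P"
    using tangent[OF vf[OF X Y] P] .
  moreover have "transpose (D X Y) = D X Y"
  proof -
    have "D X Y = transpose (D X Y)"
      unfolding D_def using X Y P
      by (intro tangent_deriv_bounded_linear[OF bounded_linear_transpose])
        (auto simp: smooth_vector_field_def tangent_space_grassmannian grassmann_tangent_def)
    then show ?thesis by simp
  qed
  ultimately have S_tangent: "S X Y \<in> grassmann_tangent P"
    using tangent_projection_mem[OF P', of "D X Y"]
    by (simp add: S_def grassmann_tangent_def transpose_distribs matrix_mult_distribs algebra_simps)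
  have "?vf W"
    unfolding W_def using S_tangent
    by (intro smooth_vector_field_tangent_projection) (simp add: grassmann_tangent_def)
  then have "S X Y \<bullet> S X Y = 0"
    using orth tangent_projection_id[OF P'(1) S_tangent] by (metis W_def)
  then show ?thesis by (simp add: S_def D_def)
qed

theorem theorem4:
  fixes q :: nat
    and X Y :: "'n::{finite,linorder} sq_matrix \<Rightarrow> 'n sq_matrix"
    and nabla :: "('n sq_matrix \<Rightarrow> 'n sq_matrix) \<Rightarrow> ('n sq_matrix \<Rightarrow> 'n sq_matrix) \<Rightarrow> ('n sq_matrix \<Rightarrow> 'n sq_matrix)"
    and \<beta> :: "'n sq_matrix"
    and I :: "real set"
    and \<Gamma> :: "real \<Rightarrow> 'n sq_matrix"
  assumes "1 \<le> q" and "q \<le> CARD('n)"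
    and "levi_civita (grassmannian q) (grassmann_metric q) nabla"
    and "smooth_vector_field (grassmannian q) X"
    and "smooth_vector_field (grassmannian q) Y"
    and "\<beta> \<in> grassmannian q"
    and "geodesic_on (grassmannian q) nabla I \<Gamma>"
    and "0 \<in> I" and "\<Gamma> 0 = \<beta>" and "(\<Gamma> has_vector_derivative X \<beta>) (at 0)"
  shows "\<exists>\<Omega>'. ((\<lambda>t. commutator (Y (\<Gamma> t)) (\<Gamma> t)) has_vector_derivative \<Omega>') (at 0) \<and>
              nabla X Y \<beta> = commutator \<Omega>' \<beta>"
proof -
  let ?D = "tangent_deriv (grassmannian q) Y \<beta> (X \<beta>)"
  note \<beta> = grassmannianD(1,2)[OF assms(6)]
  \<comment> \<open>Restricted to a symmetric interval inside \<open>I\<close>, the geodesic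
    represents the tangent vector \<open>X \<beta>\<close>, so derivatives of \<open>Y\<close> along
    it are tangential derivatives.\<close>
  have "curve_through (grassmannian q) \<beta> (X \<beta>) \<Gamma>"
  proof -
    have I: "open I" "smooth_on I \<Gamma>" "\<Gamma> ` I \<subseteq> grassmannian q"
      using assms(7) by (auto simp: geodesic_on_def)
    then obtain e where "e > 0" "ball 0 e \<subseteq> I"
      using assms(8) open_contains_ball by blast
    moreover have "ball (0::real) e = {-e<..<e}"
      by (auto simp: dist_real_def)
    ultimately have "e > 0 \<and> smooth_on {-e<..<e} \<Gamma> \<and> \<Gamma> ` {-e<..<e} \<subseteq> grassmannian q"
      using I(3) smooth_on_subset[OF I(2), of "{-e<..<e}"] by auto
    then show ?thesis
      using assms(9,10) unfolding curve_through_def by blast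
  qed
  then have "((\<lambda>t. Y (\<Gamma> t)) has_vector_derivative ?D) (at 0)"
    using assms(5) by (auto simp: smooth_vector_field_def intro: tangent_deriv_curve)
  \<comment> \<open>The product rule gives \<Omega>' as the sum of
    \<open>commutator (Y \<beta>) (X \<beta>)\<close> and
    \<open>commutator ?D \<beta>\<close>.\<close>
  from has_vector_derivative_diff[OF
      bounded_bilinear.has_vector_derivative[OF bounded_bilinear_matrix_mult this assms(10)]
      bounded_bilinear.has_vector_derivative[OF bounded_bilinear_matrix_mult assms(10) this]]
  have "((\<lambda>t. commutator (Y (\<Gamma> t)) (\<Gamma> t)) has_vector_derivative
      commutator (Y \<beta>) (X \<beta>) + commutator ?D \<beta>) (at 0)"
    by (simp add: commutator_def assms(9) algebra_simps)
  moreover have "commutator (commutator (Y \<beta>) (X \<beta>)) \<beta> = 0"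
    using assms(4-6) by (intro commutator_commutes_tangent \<beta>)
      (auto simp: smooth_vector_field_def tangent_space_grassmannian)
  then have "commutator (commutator (Y \<beta>) (X \<beta>) + commutator ?D \<beta>) \<beta> = commutator (commutator ?D \<beta>) \<beta>"
    by (simp add: commutator_def matrix_mult_distribs algebra_simps)
  moreover have "nabla X Y \<beta> = commutator (commutator ?D \<beta>) \<beta>"
    using levi_civita_grassmannian[OF assms(3,2,4,5,6)] tangent_projection_eq_commutator[OF \<beta>(1)] by simp
  ultimately show ?thesis by metis
qed

end
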